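(* Let $\mathbb{T}$ be a completely ordered monad with a binary algebraic operation $\oplus$, let $B$ be an observation pattern over $A$, and let $(X,f:X\to T(X\times A))$ be a coalgebra. Then an equivalence relation $E\subseteq X\times X$ is a $B$-$\oplus$-bisimulation on $(X,f)$ if and only if $E$ is a kernel bisimulation equivalence on the coalgebra $(X,f^B_{\mathrm{id}}:X\to(TX)^B)$ for the functor $Y\mapsto (TY)^B$.
   Context: Monads are Kleisli triples $(T,\eta,(-)^\dagger)$ ($f^\dagger\eta=f$, $\eta^\dagger=\mathrm{id}$, $(f^\dagger g)^\dagger=f^\dagger g^\dagger$), $Tu=(\eta\circ u)^\dagger$; the functor $Y\mapsto(TY)^B$ acts on maps $u$ by applying $Tu$ componentwise. Completely ordered: each set of maps $X\to TY$ is a directed-complete partial order with least element and Kleisli composition preserves directed joins in each argument. Algebraic operation: natural transformation $\oplus:(T-)^2\to T-$ with $\oplus_Y\circ(g^\dagger\times g^\dagger)=g^\dagger\circ\oplus_X$ for all $g:X\to TY$. Observation pattern: $B\subseteq\mathcal{P}(A^* )$ with $b/a=\{w\mid aw\in b\}\in B$ for $b\in B,a\in A$. For $h:X\to Y$, $f^B_h:X\to(TY)^B$ is the least map (pointwise order) with $f^B_h(x)(b)=e_b(x)\oplus(\lambda(y,a).f^B_h(y)(b/a))^\dagger(f(x))$, $e_b(x)=\eta_Y(h(x))$ if $\epsilon\in b$ and $\bot$ otherwise. An equivalence $E$ is a $B$-$\oplus$-bisimulation on $(X,f)$ if $E\subseteq\mathrm{Ker}(f^B_\pi)$ with $\pi:X\to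 X/E$ the projection. For a functor $H$, $E$ is a kernel bisimulation on an $H$-coalgebra $(X,k)$ if $E=\mathrm{Ker}\,\phi$ for some coalgebra morphism $\phi:(X,k)\to(Z,l)$ (i.e. $l\circ\phi=H\phi\circ k$). *)

theory Defs
  imports Main "HOL-Library.FuncSet"
begin

section \<open>Sets and maps\<close>

text \<open>
  HOL cannot quantify over type constructors, so the category of sets is modelled inside a type
  \<open>'u\<close>: its objects are the small subsets of \<open>'u\<close> and its maps \<open>X \<rightarrow> Y\<close> are the elements of
  \<open>X \<rightarrow>\<^sub>E Y\<close>. Every small subset is injectively coded by an element of \<open>'u\<close>, so that
  pairs and equivalence classes are again elements of \<open>'u\<close>. In a set-theoretic universe
  \<open>code\<close> is the identity, and small means being a set rather than a proper class.
\<close>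

locale set_universe =
  fixes small :: "'u set \<Rightarrow> bool"
    and code :: "'u set \<Rightarrow> 'u"
  assumes small_finite: "finite S \<Longrightarrow> small S"
    and small_subset: "small S \<Longrightarrow> S' \<subseteq> S \<Longrightarrow> small S'"
    and small_image: "small S \<Longrightarrow> small (g ` S)"
    and small_UN: "small S \<Longrightarrow> (\<And>x. x \<in> S \<Longrightarrow> small (F x)) \<Longrightarrow> small (\<Union>x\<in>S. F x)"
    and inj_code: "inj_on code {S. small S}"

text \<open>Such universes exist with small sets of any prescribed infinite cardinality.\<close>

lemma set_universe_exists:
  includes cardinal_syntax
  assumes inf: "infinite (UNIV :: 'k set)"
  shows "\<exists>code. set_universe (\<lambda>S :: 'k set set. |S| \<le>o |UNIV :: 'k set| ) code"
proof -
  let ?small = "\<lambda>S :: 'k set set. |S| \<le>o |UNIV :: 'k set|"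
  have "|UNIV \<times> UNIV :: ('k \<times> 'k) set| \<le>o |UNIV :: 'k set|"
    using card_of_Times_same_infinite[OF inf] ordIso_iff_ordLeq by blast
  then obtain p :: "'k \<times> 'k \<Rightarrow> 'k" where p: "inj p"
    using card_of_ordLeq[of "UNIV \<times> UNIV :: ('k \<times> 'k) set" "UNIV :: 'k set"] by auto
  obtain a b :: 'k where ab: "a \<noteq> b"
  proof -
    fix a :: 'k
    have "UNIV \<noteq> {a}" using inf by (metis finite.emptyI finite.insertI)
    then show thesis using that by blast
  qed
  define e where "e S = (SOME e :: 'k \<Rightarrow> 'k set. range e = S)" for S
  have e: "range (e S) = S" if "?small S" "S \<noteq> {}" for S
  proof -
    have "\<exists>e :: 'k \<Rightarrow> 'k set. range e = S"
      using that card_of_ordLeq2[of S "UNIV :: 'k set"] by simp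
    then show ?thesis unfolding e_def by (rule someI_ex)
  qed
  define G where "G S = {(i, j). j \<in> e S i}" for S
  define q where "q = (\<lambda>(i, j). p (p (a, i), j))"
  have peq: "p u = p v \<longleftrightarrow> u = v" for u v using p by (rule inj_eq)
  have q: "inj q" by (rule injI) (simp add: q_def peq split: prod.splits)
  have q': "p (p (b, a), a) \<notin> range q" using ab by (auto simp: q_def peq)
  define code where "code S = (if S = {} then {p (p (b, a), a)} else q ` G S)" for S
  have "S = S'" if s: "?small S" "?small S'" and c: "code S = code S'" for S S'
  proof (cases "S = {} \<or> S' = {}")
    case True
    have "code R \<noteq> code {}" if "R \<noteq> {}" for R
    proof
      assume "code R = code {}"
      then have "q ` G R = {p (p (b, a), a)}" using that by (simp add: code_def)
      then show False using q' by blast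
    qed
    then show ?thesis using c True by metis
  next
    case False
    then have "G S = G S'" using c q by (simp add: code_def inj_image_eq_iff)
    then have "(i, j) \<in> G S \<longleftrightarrow> (i, j) \<in> G S'" for i j by simp
    then have "e S i = e S' i" for i by (intro set_eqI) (simp add: G_def)
    then have "e S = e S'" by (rule ext)
    then have "range (e S) = range (e S')" by (rule arg_cong)
    moreover have "range (e S) = S" "range (e S') = S'" using e s False by blast+
    ultimately show ?thesis by (rule box_equals)
  qed
  then have inj: "inj_on code {S. ?small S}" by (intro inj_onI) simp
  have "set_universe ?small code"
  proof (unfold_locales, goal_cases)
    case (1 S)
    then show ?case
      using inf ordLeq_total[OF card_of_Well_order card_of_Well_order] card_of_ordLeq_finite by blast
  next
    case (2 S S')
    then show ?case using card_of_mono1 ordLeq_transitive by blast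
  next
    case (3 S g)
    then show ?case using card_of_image ordLeq_transitive by blast
  next
    case (4 S F)
    then show ?case by (intro card_of_UNION_ordLeq_infinite inf) auto
  next
    case 5
    show ?case by (rule inj)
  qed
  then show ?thesis by blast
qed

text \<open>Kuratowski pairs.\<close>

definition pr :: "('u set \<Rightarrow> 'u) \<Rightarrow> 'u \<Rightarrow> 'u \<Rightarrow> 'u" where
  "pr code x y = code {code {x}, code {x, y}}"

definition prod_obj :: "('u set \<Rightarrow> 'u) \<Rightarrow> 'u set \<Rightarrow> 'u set \<Rightarrow> 'u set" where
  "prod_obj code X A = (\<lambda>(x, a). pr code x a) ` (X \<times> A)"

text \<open>The map \<open>\<lambda>(y, a). g y a\<close> on \<open>prod_obj code X A\<close>.\<close>

definition uncurry :: "('u set \<Rightarrow> 'u) \<Rightarrow> 'u set \<Rightarrow> 'u set \<Rightarrow> ('u \<Rightarrow> 'u \<Rightarrow> 't) \<Rightarrow> 'u \<Rightarrow> 't" where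
  "uncurry code X A g =
    (\<lambda>p\<in>prod_obj code X A. case_prod g (inv_into (X \<times> A) (\<lambda>(x, a). pr code x a) p))"

definition quot :: "('u set \<Rightarrow> 'u) \<Rightarrow> 'u set \<Rightarrow> 'u rel \<Rightarrow> 'u set" where
  "quot code X E = code ` (X // E)"

definition quot_proj :: "('u set \<Rightarrow> 'u) \<Rightarrow> 'u set \<Rightarrow> 'u rel \<Rightarrow> 'u \<Rightarrow> 'u" where
  "quot_proj code X E = (\<lambda>x\<in>X. code (E `` {x}))"

definition ker :: "'u set \<Rightarrow> ('u \<Rightarrow> 'v) \<Rightarrow> 'u rel" where
  "ker X \<phi> = {(x, y). x \<in> X \<and> y \<in> X \<and> \<phi> x = \<phi> y}"


section \<open>Completely ordered monads\<close>

text \<open>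
  A Kleisli triple never iterates \<open>T\<close>, so the elements of \<open>T X\<close> may live in a type \<open>'t\<close> other
  than \<open>'u\<close>; a universe closed under \<open>T\<close> is the case \<open>'t = 'u\<close>. The indices of
  \<open>ret\<close> and \<open>ext\<close> are the objects involved: \<open>ext M X Y f\<close> is the extension of \<open>f : X \<rightarrow> T Y\<close>.
\<close>

record ('u, 't) kleisli =
  T :: "'u set \<Rightarrow> 't set"
  ret :: "'u set \<Rightarrow> 'u \<Rightarrow> 't"
  ext :: "'u set \<Rightarrow> 'u set \<Rightarrow> ('u \<Rightarrow> 't) \<Rightarrow> 't \<Rightarrow> 't"

record ('u, 't) ordered_kleisli = "('u, 't) kleisli" +
  leq :: "'u set \<Rightarrow> 't \<Rightarrow> 't \<Rightarrow> bool"

locale monad =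
  fixes small :: "'u set \<Rightarrow> bool"
    and M :: "('u, 't, 'm) kleisli_scheme"
  assumes ret_type: "small X \<Longrightarrow> ret M X \<in> X \<rightarrow>\<^sub>E T M X"
    and ext_type: "small X \<Longrightarrow> small Y \<Longrightarrow> f \<in> X \<rightarrow>\<^sub>E T M Y \<Longrightarrow> ext M X Y f \<in> T M X \<rightarrow>\<^sub>E T M Y"
    and ext_ret: "small X \<Longrightarrow> small Y \<Longrightarrow> f \<in> X \<rightarrow>\<^sub>E T M Y \<Longrightarrow>
      compose X (ext M X Y f) (ret M X) = f"
    and ret_ext: "small X \<Longrightarrow> ext M X X (ret M X) = (\<lambda>t\<in>T M X. t)"
    and ext_ext: "small X \<Longrightarrow> small Y \<Longrightarrow> small Z \<Longrightarrow> f \<in> Y \<rightarrow>\<^sub>E T M Z \<Longrightarrow> g \<in> X \<rightarrow>\<^sub>E T M Y \<Longrightarrow>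
      ext M X Z (compose X (ext M Y Z f) g) = compose (T M X) (ext M Y Z f) (ext M X Y g)"

definition Tmap :: "('u, 't, 'm) kleisli_scheme \<Rightarrow> 'u set \<Rightarrow> 'u set \<Rightarrow> ('u \<Rightarrow> 'u) \<Rightarrow> 't \<Rightarrow> 't" where
  "Tmap M X Y u = ext M X Y (compose X (ret M Y) u)"

definition directed :: "'a rel \<Rightarrow> 'a set \<Rightarrow> bool" where
  "directed r D \<longleftrightarrow> D \<noteq> {} \<and> (\<forall>x\<in>D. \<forall>y\<in>D. \<exists>z\<in>D. (x, z) \<in> r \<and> (y, z) \<in> r)"

definition is_join :: "'a rel \<Rightarrow> 'a set \<Rightarrow> 'a \<Rightarrow> bool" where
  "is_join r D s \<longleftrightarrow> (\<forall>d\<in>D. (d, s) \<in> r) \<and> (\<forall>u. (\<forall>d\<in>D. (d, u) \<in> r) \<longrightarrow> (s, u) \<in> r)"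

definition hom_order ::
  "('u, 't, 'm) ordered_kleisli_scheme \<Rightarrow> 'u set \<Rightarrow> 'u set \<Rightarrow> ('u \<Rightarrow> 't) rel" where
  "hom_order M X Y =
    {(f, g). f \<in> X \<rightarrow>\<^sub>E T M Y \<and> g \<in> X \<rightarrow>\<^sub>E T M Y \<and> (\<forall>x\<in>X. leq M Y (f x) (g x))}"

locale completely_ordered_monad = monad small M
  for small :: "'u set \<Rightarrow> bool"
    and M :: "('u, 't, 'm) ordered_kleisli_scheme" +
  assumes hom_partial_order: "small X \<Longrightarrow> small Y \<Longrightarrow>
      partial_order_on (X \<rightarrow>\<^sub>E T M Y) (hom_order M X Y)"
    and hom_directed_complete: "small X \<Longrightarrow> small Y \<Longrightarrow>
      D \<subseteq> X \<rightarrow>\<^sub>E T M Y \<Longrightarrow> directed (hom_order M X Y) D \<Longrightarrow> \<exists>s. is_join (hom_order M X Y) D s"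
    and hom_least: "small X \<Longrightarrow> small Y \<Longrightarrow>
      \<exists>f \<in> X \<rightarrow>\<^sub>E T M Y. \<forall>g \<in> X \<rightarrow>\<^sub>E T M Y. (f, g) \<in> hom_order M X Y"
    and comp_join_inner: "small X \<Longrightarrow> small Y \<Longrightarrow> small Z \<Longrightarrow> g \<in> Y \<rightarrow>\<^sub>E T M Z \<Longrightarrow>
      D \<subseteq> X \<rightarrow>\<^sub>E T M Y \<Longrightarrow> directed (hom_order M X Y) D \<Longrightarrow> is_join (hom_order M X Y) D s \<Longrightarrow>
      is_join (hom_order M X Z) ((\<lambda>d. compose X (ext M Y Z g) d) ` D) (compose X (ext M Y Z g) s)"
    and comp_join_outer: "small X \<Longrightarrow> small Y \<Longrightarrow> small Z \<Longrightarrow> g \<in> X \<rightarrow>\<^sub>E T M Y \<Longrightarrow>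
      D \<subseteq> Y \<rightarrow>\<^sub>E T M Z \<Longrightarrow> directed (hom_order M Y Z) D \<Longrightarrow> is_join (hom_order M Y Z) D s \<Longrightarrow>
      is_join (hom_order M X Z) ((\<lambda>d. compose X (ext M Y Z d) g) ` D) (compose X (ext M Y Z s) g)"

definition bottom :: "('u, 't, 'm) ordered_kleisli_scheme \<Rightarrow> 'u set \<Rightarrow> 't" where
  "bottom M Y = (THE t. t \<in> T M Y \<and> (\<forall>t'\<in>T M Y. leq M Y t t'))"

locale algebraic_operation = monad small M
  for small :: "'u set \<Rightarrow> bool"
    and M :: "('u, 't, 'm) kleisli_scheme" +
  fixes oplus :: "'u set \<Rightarrow> 't \<Rightarrow> 't \<Rightarrow> 't"
  assumes oplus_type: "small Y \<Longrightarrow> p \<in> T M Y \<Longrightarrow> q \<in> T M Y \<Longrightarrow> oplus Y p q \<in> T M Y"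
    and oplus_natural: "small X \<Longrightarrow> small Y \<Longrightarrow> u \<in> X \<rightarrow>\<^sub>E Y \<Longrightarrow> p \<in> T M X \<Longrightarrow> q \<in> T M X \<Longrightarrow>
      oplus Y (Tmap M X Y u p) (Tmap M X Y u q) = Tmap M X Y u (oplus X p q)"
    and oplus_algebraic: "small X \<Longrightarrow> small Y \<Longrightarrow> g \<in> X \<rightarrow>\<^sub>E T M Y \<Longrightarrow> p \<in> T M X \<Longrightarrow> q \<in> T M X \<Longrightarrow>
      oplus Y (ext M X Y g p) (ext M X Y g q) = ext M X Y g (oplus X p q)"


section \<open>Observations and bisimulations\<close>

definition word_deriv :: "'a \<Rightarrow> 'a list set \<Rightarrow> 'a list set" where
  "word_deriv a b = {w. a # w \<in> b}"

definition observation_pattern :: "'a set \<Rightarrow> 'a list set set \<Rightarrow> bool" where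
  "observation_pattern A B \<longleftrightarrow> B \<subseteq> Pow (lists A) \<and> (\<forall>b\<in>B. \<forall>a\<in>A. word_deriv a b \<in> B)"

text \<open>The object part and the map part of the functor sending \<open>Y\<close> to \<open>(T Y)\<^sup>B\<close>.\<close>

definition powT :: "('u, 't, 'm) kleisli_scheme \<Rightarrow> 'b set \<Rightarrow> 'u set \<Rightarrow> ('b \<Rightarrow> 't) set" where
  "powT M B Y = B \<rightarrow>\<^sub>E T M Y"

definition powT_map :: "('u, 't, 'm) kleisli_scheme \<Rightarrow> 'b set \<Rightarrow>
    'u set \<Rightarrow> 'u set \<Rightarrow> ('u \<Rightarrow> 'u) \<Rightarrow> ('b \<Rightarrow> 't) \<Rightarrow> ('b \<Rightarrow> 't)" where
  "powT_map M B X Y u = (\<lambda>k\<in>powT M B X. \<lambda>b\<in>B. Tmap M X Y u (k b))"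

definition obs_solution :: "('u set \<Rightarrow> 'u) \<Rightarrow> ('u, 't, 'm) ordered_kleisli_scheme \<Rightarrow>
    ('u set \<Rightarrow> 't \<Rightarrow> 't \<Rightarrow> 't) \<Rightarrow> 'u set \<Rightarrow> 'u list set set \<Rightarrow> 'u set \<Rightarrow> ('u \<Rightarrow> 't) \<Rightarrow>
    'u set \<Rightarrow> ('u \<Rightarrow> 'u) \<Rightarrow> ('u \<Rightarrow> 'u list set \<Rightarrow> 't) \<Rightarrow> bool" where
  "obs_solution code M oplus A B X f Y h g \<longleftrightarrow>
    g \<in> X \<rightarrow>\<^sub>E powT M B Y \<and>
    (\<forall>x\<in>X. \<forall>b\<in>B. g x b =
      oplus Y (if [] \<in> b then ret M Y (h x) else bottom M Y)
        (ext M (prod_obj code X A) Y (uncurry code X A (\<lambda>y a. g y (word_deriv a b))) (f x)))"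

text \<open>\<open>obs code M oplus A B X f Y h\<close> is the map \<open>f\<^sup>B\<^sub>h\<close> for \<open>h : X \<rightarrow> Y\<close>.\<close>

definition obs :: "('u set \<Rightarrow> 'u) \<Rightarrow> ('u, 't, 'm) ordered_kleisli_scheme \<Rightarrow>
    ('u set \<Rightarrow> 't \<Rightarrow> 't \<Rightarrow> 't) \<Rightarrow> 'u set \<Rightarrow> 'u list set set \<Rightarrow> 'u set \<Rightarrow> ('u \<Rightarrow> 't) \<Rightarrow>
    'u set \<Rightarrow> ('u \<Rightarrow> 'u) \<Rightarrow> ('u \<Rightarrow> 'u list set \<Rightarrow> 't)" where
  "obs code M oplus A B X f Y h = (THE g. obs_solution code M oplus A B X f Y h g \<and>
    (\<forall>g'. obs_solution code M oplus A B X f Y h g' \<longrightarrow> (\<forall>x\<in>X. \<forall>b\<in>B. leq M Y (g x b) (g' x b))))"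

definition B_bisimulation :: "('u set \<Rightarrow> 'u) \<Rightarrow> ('u, 't, 'm) ordered_kleisli_scheme \<Rightarrow>
    ('u set \<Rightarrow> 't \<Rightarrow> 't \<Rightarrow> 't) \<Rightarrow> 'u set \<Rightarrow> 'u list set set \<Rightarrow> 'u set \<Rightarrow> ('u \<Rightarrow> 't) \<Rightarrow>
    'u rel \<Rightarrow> bool" where
  "B_bisimulation code M oplus A B X f E \<longleftrightarrow>
    equiv X E \<and> E \<subseteq> ker X (obs code M oplus A B X f (quot code X E) (quot_proj code X E))"

text \<open>Here \<open>H\<close> and \<open>Hmap\<close> are the object and map parts of a functor.\<close>

definition coalgebra_morphism :: "('u set \<Rightarrow> 'u set \<Rightarrow> ('u \<Rightarrow> 'u) \<Rightarrow> 'c \<Rightarrow> 'c) \<Rightarrow>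
    'u set \<Rightarrow> ('u \<Rightarrow> 'c) \<Rightarrow> 'u set \<Rightarrow> ('u \<Rightarrow> 'c) \<Rightarrow> ('u \<Rightarrow> 'u) \<Rightarrow> bool" where
  "coalgebra_morphism Hmap X k Z l \<phi> \<longleftrightarrow>
    \<phi> \<in> X \<rightarrow>\<^sub>E Z \<and> compose X l \<phi> = compose X (Hmap X Z \<phi>) k"

definition kernel_bisimulation :: "('u set \<Rightarrow> bool) \<Rightarrow> ('u set \<Rightarrow> 'c set) \<Rightarrow>
    ('u set \<Rightarrow> 'u set \<Rightarrow> ('u \<Rightarrow> 'u) \<Rightarrow> 'c \<Rightarrow> 'c) \<Rightarrow> 'u set \<Rightarrow> ('u \<Rightarrow> 'c) \<Rightarrow> 'u rel \<Rightarrow> bool" where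
  "kernel_bisimulation small H Hmap X k E \<longleftrightarrow>
    (\<exists>Z l \<phi>. small Z \<and> l \<in> Z \<rightarrow>\<^sub>E H Z \<and> coalgebra_morphism Hmap X k Z l \<phi> \<and> E = ker X \<phi>)"

end

theory Submission
  imports Defs
begin

text \<open>
  The crux is the identity \<open>f\<^sup>B\<^sub>\<pi> = (T \<pi>)\<^sup>B \<circ> f\<^sup>B\<^sub>i\<^sub>d\<close> for a surjection \<open>\<pi>\<close>. An algebraic operation is
  Kleisli extension applied to a generic effect in \<open>T 2\<close>, hence continuous, so both sides are
  joins of Kleene iterates and the identity reduces to the iterates. Kleisli composition need not
  be strict, but \<open>T \<pi>\<close> preserves the least element because \<open>\<pi>\<close> has a section \<open>s\<close>:
  \<open>T \<pi> \<bottom> \<le> T \<pi> (T s \<bottom>) = \<bottom>\<close>. Given the identity, a bisimulation yields a coalgebra structure on the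
  quotient. Conversely a morphism with kernel \<open>E\<close> factors as \<open>m \<circ> \<pi>\<close> with \<open>m\<close> injective, and
  \<open>T m\<close> is injective because \<open>m\<close> has a retraction when \<open>X\<close> is nonempty.
\<close>

section \<open>Joins and maps out of coded products\<close>

lemma is_join_unique:
  assumes "is_join r D s" "is_join r D s'" "antisym r"
  shows "s = s'"
  using assms unfolding is_join_def antisym_def by blast

lemma uncurry_type:
  assumes "\<And>x a. x \<in> X \<Longrightarrow> a \<in> A \<Longrightarrow> g x a \<in> S"
  shows "uncurry code X A g \<in> prod_obj code X A \<rightarrow>\<^sub>E S"
proof
  fix p assume p: "p \<in> prod_obj code X A"
  then have "inv_into (X \<times> A) (\<lambda>(x, a). pr code x a) p \<in> X \<times> A"
    unfolding prod_obj_def by (rule inv_into_into)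
  then show "uncurry code X A g p \<in> S"
    using p assms by (auto simp: uncurry_def split: prod.splits)
qed (simp add: uncurry_def)

text \<open>Used to evaluate \<open>uncurry\<close> at an element of the product: its value there is
  the value of the curried map at the decoded components, which lie in \<open>X\<close> and
  \<open>A\<close>.\<close>

lemma prod_obj_inv:
  assumes "p \<in> prod_obj code X A"
  obtains x a where "x \<in> X" "a \<in> A" "inv_into (X \<times> A) (\<lambda>(x, a). pr code x a) p = (x, a)"
proof -
  obtain x a where xa: "inv_into (X \<times> A) (\<lambda>(x, a). pr code x a) p = (x, a)" by fastforce
  have "inv_into (X \<times> A) (\<lambda>(x, a). pr code x a) p \<in> X \<times> A"
    using assms unfolding prod_obj_def by (rule inv_into_into)
  then have "x \<in> X" "a \<in> A" using xa by auto
  then show thesis using xa by (rule that)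
qed

text \<open>Both sides decode their argument by the same chosen inverse. This lets
  \<open>T h\<close> be pushed into the recursive call of the observation equation.\<close>

lemma compose_uncurry:
  "compose (prod_obj code X A) k (uncurry code X A g) = uncurry code X A (\<lambda>x a. k (g x a))"
  by (auto simp: compose_def uncurry_def split: prod.splits intro!: restrict_ext)

section \<open>Smallness, and the kernel of the quotient projection\<close>

context set_universe
begin

lemma small_prod_obj:
  assumes "small X" "small A"
  shows "small (prod_obj code X A)"
proof -
  have "prod_obj code X A = (\<Union>x\<in>X. pr code x ` A)" by (auto simp: prod_obj_def)
  then show ?thesis using assms by (simp add: small_UN small_image)
qed

text \<open>The empty set and a singleton are distinct small sets, so their codes differ. The two
  elements form the arity object of a binary operation.\<close>

lemma two_elements:
  obtains c d :: 'u where "c \<noteq> d"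
proof -
  have "code {} \<noteq> code {code {}}"
    using inj_onD[OF inj_code, of "{}" "{code {}}"] small_finite by auto
  then show thesis by (rule that)
qed

lemma small_quot:
  assumes "small X"
  shows "small (quot code X E)"
proof -
  have "quot code X E = (\<lambda>x. code (E `` {x})) ` X" by (auto simp: quot_def quotient_def)
  then show ?thesis using assms by (simp add: small_image)
qed

lemma quot_proj_type: "quot_proj code X E \<in> X \<rightarrow>\<^sub>E quot code X E"
  by (auto simp: quot_proj_def quot_def quotientI)

lemma quot_proj_surj: "quot_proj code X E ` X = quot code X E"
  by (auto simp: quot_proj_def quot_def quotient_def)

text \<open>Equivalence classes are subsets of the small set \<open>X\<close>, hence small, and
  \<open>code\<close> is injective on small sets; so two points have the same image exactly when
  their classes agree.\<close>

lemma ker_quot_proj: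
  assumes "small X" "equiv X E"
  shows "ker X (quot_proj code X E) = E"
proof -
  have sm: "small (E `` {x})" for x
    using assms by (intro small_subset[OF \<open>small X\<close>]) (auto simp: equiv_class_eq_iff)
  have "code (E `` {x}) = code (E `` {y}) \<longleftrightarrow> E `` {x} = E `` {y}" for x y
    using inj_on_eq_iff[OF inj_code] sm by simp
  then show ?thesis
    using equiv_class_eq_iff[OF \<open>equiv X E\<close>] by (auto simp: ker_def quot_proj_def)
qed

end

section \<open>Functor laws derived from the Kleisli triple\<close>

context monad
begin

lemma ext_in:
  assumes "small X" "small Y" "f \<in> X \<rightarrow>\<^sub>E T M Y" "t \<in> T M X"
  shows "ext M X Y f t \<in> T M Y"
  using ext_type[OF assms(1-3)] assms(4) by auto

lemma ret_in:
  assumes "small X" "x \<in> X"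
  shows "ret M X x \<in> T M X"
  using ret_type[OF assms(1)] assms(2) by auto

lemma ext_ret_apply:
  assumes "small X" "small Y" "f \<in> X \<rightarrow>\<^sub>E T M Y" "x \<in> X"
  shows "ext M X Y f (ret M X x) = f x"
  using fun_cong[OF ext_ret[OF assms(1-3)], of x] assms(4) by (simp add: compose_def)

lemma ext_ext_apply:
  assumes "small X" "small Y" "small Z" "f \<in> Y \<rightarrow>\<^sub>E T M Z" "g \<in> X \<rightarrow>\<^sub>E T M Y" "t \<in> T M X"
  shows "ext M Y Z f (ext M X Y g t) = ext M X Z (compose X (ext M Y Z f) g) t"
  using fun_cong[OF ext_ext[OF assms(1-5)], of t] assms(6) by (simp add: compose_def)

lemma ret_comp_type:
  assumes "small Y" "u \<in> X \<rightarrow>\<^sub>E Y"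
  shows "compose X (ret M Y) u \<in> X \<rightarrow>\<^sub>E T M Y"
  using assms ret_in by (auto simp: compose_def)

lemma Tmap_in:
  assumes "small X" "small Y" "u \<in> X \<rightarrow>\<^sub>E Y" "t \<in> T M X"
  shows "Tmap M X Y u t \<in> T M Y"
  unfolding Tmap_def using assms by (intro ext_in ret_comp_type)

lemma Tmap_ret:
  assumes "small X" "small Y" "u \<in> X \<rightarrow>\<^sub>E Y" "x \<in> X"
  shows "Tmap M X Y u (ret M X x) = ret M Y (u x)"
  unfolding Tmap_def ext_ret_apply[OF assms(1,2) ret_comp_type[OF assms(2,3)] assms(4)]
  using assms(4) by (simp add: compose_def)

lemma Tmap_ext:
  assumes "small X" "small Y" "small Z" "u \<in> Y \<rightarrow>\<^sub>E Z" "g \<in> X \<rightarrow>\<^sub>E T M Y" "t \<in> T M X"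
  shows "Tmap M Y Z u (ext M X Y g t) = ext M X Z (compose X (Tmap M Y Z u) g) t"
  unfolding Tmap_def using assms by (intro ext_ext_apply ret_comp_type)

lemma Tmap_Tmap:
  assumes "small X" "small Y" "small Z" "v \<in> Y \<rightarrow>\<^sub>E Z" "u \<in> X \<rightarrow>\<^sub>E Y" "t \<in> T M X"
  shows "Tmap M Y Z v (Tmap M X Y u t) = Tmap M X Z (compose X v u) t"
proof -
  have "compose X (Tmap M Y Z v) (compose X (ret M Y) u) = compose X (ret M Z) (compose X v u)"
    using assms by (auto simp: compose_def Tmap_ret[OF assms(2-4)] dest: PiE_mem intro!: restrict_ext)
  then show ?thesis
    using Tmap_ext[OF assms(1-4) ret_comp_type[OF assms(2,5)] assms(6)]
    by (simp add: Tmap_def)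
qed

lemma Tmap_id:
  assumes "small X" "t \<in> T M X"
  shows "Tmap M X X (\<lambda>x\<in>X. x) t = t"
proof -
  have "compose X (ret M X) (\<lambda>x\<in>X. x) = ret M X"
    using ret_type[OF assms(1)] by (auto simp: compose_def PiE_def extensional_def)
  then show ?thesis using assms ret_ext[OF assms(1)] by (simp add: Tmap_def)
qed

end

section \<open>The order on \<open>T Y\<close>, read off from maps out of a point\<close>

context completely_ordered_monad
begin

text \<open>Membership in \<open>T M Y\<close> is built into the relation because
  \<open>is_join\<close> tests upper bounds from the whole type.\<close>

definition T_order :: "'u set \<Rightarrow> 't rel" where
  "T_order Y = {(p, q). p \<in> T M Y \<and> q \<in> T M Y \<and> leq M Y p q}"

text \<open>Elements of \<open>T Y\<close> are identified with maps from the one-element set \<open>{undefined}\<close>.\<close>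

abbreviation point :: "'t \<Rightarrow> 'u \<Rightarrow> 't" where
  "point t \<equiv> \<lambda>x\<in>{undefined}. t"

lemma point_type: "point t \<in> {undefined} \<rightarrow>\<^sub>E T M Y \<longleftrightarrow> t \<in> T M Y"
  by (auto simp: PiE_def Pi_def extensional_def restrict_def)

lemma point_cases:
  assumes "g \<in> {undefined} \<rightarrow>\<^sub>E T M Y"
  obtains t where "g = point t" "t \<in> T M Y"
proof
  show "g = point (g undefined)" using assms by (auto simp: PiE_def extensional_def)
  show "g undefined \<in> T M Y" using assms by auto
qed

lemma point_inject: "point s = point t \<longleftrightarrow> s = t"
  by (metis restrict_apply' singletonI)

lemma point_order: "(point s, point t) \<in> hom_order M {undefined} Y \<longleftrightarrow> (s, t) \<in> T_order Y"
  unfolding hom_order_def T_order_def using point_type by auto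

end

locale universe_ordered_monad = set_universe small code + completely_ordered_monad small M
  for small :: "'u set \<Rightarrow> bool"
    and code :: "'u set \<Rightarrow> 'u"
    and M :: "('u, 't, 'm) ordered_kleisli_scheme"
begin

lemma small_point: "small {undefined}"
  by (simp add: small_finite)

lemma T_order_refl:
  assumes "small Y" "t \<in> T M Y"
  shows "(t, t) \<in> T_order Y"
  using hom_partial_order[OF small_point assms(1)] assms(2) point_order point_type
  unfolding partial_order_on_def preorder_on_def refl_on_def by blast

lemma T_order_trans:
  assumes "small Y"
  shows "trans (T_order Y)"
  using hom_partial_order[OF small_point assms]
  unfolding partial_order_on_def preorder_on_def trans_def point_order[symmetric] by blast

lemma T_order_antisym:
  assumes "small Y"
  shows "antisym (T_order Y)"
  using hom_partial_order[OF small_point assms]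
  unfolding partial_order_on_def antisym_def point_order[symmetric]
  using point_inject by blast

text \<open>The description defining \<open>bottom\<close> denotes: existence comes from the least
  map out of the one-point object, uniqueness from antisymmetry.\<close>

lemma bottom_least:
  assumes "small Y"
  shows "bottom M Y \<in> T M Y \<and> (\<forall>t\<in>T M Y. (bottom M Y, t) \<in> T_order Y)"
proof -
  obtain g where g: "g \<in> {undefined} \<rightarrow>\<^sub>E T M Y"
      "\<forall>g' \<in> {undefined} \<rightarrow>\<^sub>E T M Y. (g, g') \<in> hom_order M {undefined} Y"
    using hom_least[OF small_point assms] by blast
  obtain t where t: "g = point t" "t \<in> T M Y" using point_cases[OF g(1)] .
  have le: "(t, t') \<in> T_order Y" if "t' \<in> T M Y" for t'
    using g(2) that t(1) point_order point_type by blast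
  have "bottom M Y = t"
    unfolding bottom_def
  proof (rule the_equality)
    show "t \<in> T M Y \<and> (\<forall>t'\<in>T M Y. leq M Y t t')" using t le by (auto simp: T_order_def)
    show "s = t" if "s \<in> T M Y \<and> (\<forall>t'\<in>T M Y. leq M Y s t')" for s
      using that t(2) le antisymD[OF T_order_antisym[OF assms], of s t]
      by (auto simp: T_order_def)
  qed
  then show ?thesis using t le by simp
qed

lemmas bottom_in = bottom_least[THEN conjunct1]

lemma is_join_point:
  assumes "D \<subseteq> T M Y" "D \<noteq> {}"
  shows "is_join (hom_order M {undefined} Y) (point ` D) (point s) \<longleftrightarrow> is_join (T_order Y) D s"
    (is "?L \<longleftrightarrow> ?R")
proof
  assume ?L
  then show ?R unfolding is_join_def by (auto simp: point_order) (metis point_order)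
next
  assume R: ?R
  show ?L unfolding is_join_def
  proof (intro conjI allI impI ballI)
    fix d assume "d \<in> point ` D"
    then show "(d, point s) \<in> hom_order M {undefined} Y"
      using R unfolding is_join_def by (auto simp: point_order)
  next
    fix u assume u: "\<forall>d\<in>point ` D. (d, u) \<in> hom_order M {undefined} Y"
    \<comment> \<open>As \<open>D\<close> is nonempty, some point lies below \<open>u\<close>, which
      forces \<open>u\<close> into the hom-set; hence \<open>u\<close> is a point itself.\<close>
    then have "u \<in> {undefined} \<rightarrow>\<^sub>E T M Y" using assms(2) unfolding hom_order_def by blast
    then obtain t where "u = point t" by (rule point_cases)
    then show "(point s, u) \<in> hom_order M {undefined} Y"
      using u R unfolding is_join_def by (auto simp: point_order)
  qed
qed

lemma directed_point:
  "directed (hom_order M {undefined} Y) (point ` D) \<longleftrightarrow> directed (T_order Y) D"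
  unfolding directed_def by (simp add: point_order)

text \<open>Composition with a point of \<open>T X\<close> is application to an element of
  \<open>T X\<close>, so this is continuity of composition in its inner argument with the one-point
  object as source.\<close>

lemma ext_join_inner:
  assumes "small X" "small Y" "g \<in> X \<rightarrow>\<^sub>E T M Y" "D \<subseteq> T M X"
    and "directed (T_order X) D" "is_join (T_order X) D s"
  shows "is_join (T_order Y) (ext M X Y g ` D) (ext M X Y g s)"
proof -
  have ne: "D \<noteq> {}" using assms(5) by (simp add: directed_def)
  have c: "compose {undefined} (ext M X Y g) (point d) = point (ext M X Y g d)" for d
    by (auto simp: compose_def)
  have "point ` D \<subseteq> {undefined} \<rightarrow>\<^sub>E T M X" using assms(4) point_type by blast
  moreover have "is_join (hom_order M {undefined} X) (point ` D) (point s)"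
    using is_join_point assms(4,6) ne by blast
  ultimately have
    "is_join (hom_order M {undefined} Y) (point ` ext M X Y g ` D) (point (ext M X Y g s))"
    using comp_join_inner[OF small_point assms(1-3), of "point ` D" "point s"] assms(5)
    by (simp only: directed_point c image_image)
  moreover have "ext M X Y g ` D \<subseteq> T M Y" using assms(1-4) ext_in by blast
  ultimately show ?thesis using is_join_point ne by blast
qed

text \<open>Dually, the inner argument is the fixed point \<open>t\<close>, and the extended map
  varies.\<close>

lemma ext_join_outer:
  assumes "small X" "small Y" "t \<in> T M X" "D \<subseteq> X \<rightarrow>\<^sub>E T M Y"
    and "directed (hom_order M X Y) D" "is_join (hom_order M X Y) D s"
  shows "is_join (T_order Y) ((\<lambda>d. ext M X Y d t) ` D) (ext M X Y s t)"
proof -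
  have ne: "D \<noteq> {}" using assms(5) by (simp add: directed_def)
  have c: "compose {undefined} (ext M X Y d) (point t) = point (ext M X Y d t)" for d
    by (auto simp: compose_def)
  have "is_join (hom_order M {undefined} Y) (point ` (\<lambda>d. ext M X Y d t) ` D)
      (point (ext M X Y s t))"
    using comp_join_outer[OF small_point assms(1,2) _ assms(4-6), of "point t"] assms(3)
    by (simp only: point_type c image_image)
  moreover have "(\<lambda>d. ext M X Y d t) ` D \<subseteq> T M Y" using assms(1-4) ext_in by blast
  ultimately show ?thesis using is_join_point ne by blast
qed

section \<open>Continuity along sequences, and strictness of \<open>T u\<close> for surjective
  \<open>u\<close>\<close>

definition chain :: "'u set \<Rightarrow> (nat \<Rightarrow> 't) \<Rightarrow> bool" where
  "chain Y p \<longleftrightarrow> (\<forall>m n. m \<le> n \<longrightarrow> (p m, p n) \<in> T_order Y)"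

lemma chain_in: "chain Y p \<Longrightarrow> p n \<in> T M Y"
  unfolding chain_def T_order_def by blast

lemma chain_SucI:
  assumes "small Y" "\<And>n. (p n, p (Suc n)) \<in> T_order Y"
  shows "chain Y p"
  unfolding chain_def
proof (intro allI impI)
  fix m n :: nat assume "m \<le> n"
  then show "(p m, p n) \<in> T_order Y"
  proof (induction n rule: dec_induct)
    case base
    \<comment> \<open>Here the hypothesis only serves to place \<open>p m\<close> in the carrier,
      where reflexivity holds.\<close>
    show ?case using assms(2)[of m] T_order_refl[OF assms(1)] by (auto simp: T_order_def)
  next
    case (step n)
    then show ?case using assms(2)[of n] transD[OF T_order_trans[OF assms(1)]] by blast
  qed
qed

lemma chain_directed:
  assumes "chain Y p"
  shows "directed (T_order Y) (range p)"
proof -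
  have "\<exists>z\<in>range p. (p m, z) \<in> T_order Y \<and> (p n, z) \<in> T_order Y" for m n
    using assms unfolding chain_def by (intro bexI[of _ "p (max m n)"]) auto
  then show ?thesis unfolding directed_def by blast
qed

lemma chain_join:
  assumes "small Y" "chain Y p"
  obtains s where "is_join (T_order Y) (range p) s"
proof -
  have sub: "range p \<subseteq> T M Y" using chain_in[OF assms(2)] by blast
  then have "point ` range p \<subseteq> {undefined} \<rightarrow>\<^sub>E T M Y" using point_type by blast
  then obtain u where u: "is_join (hom_order M {undefined} Y) (point ` range p) u"
    using hom_directed_complete[OF small_point assms(1)] directed_point chain_directed[OF assms(2)]
    by meson
  then have "u \<in> {undefined} \<rightarrow>\<^sub>E T M Y" unfolding is_join_def hom_order_def by blast
  then obtain s where "u = point s" by (rule point_cases)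
  then show thesis using u sub that is_join_point[of "range p" Y s] by blast
qed

lemma join_in: "is_join (T_order Y) (range p) s \<Longrightarrow> s \<in> T M Y"
  unfolding is_join_def T_order_def by blast

lemma chain_const:
  assumes "small Y" "t \<in> T M Y"
  shows "chain Y (\<lambda>_. t)" "is_join (T_order Y) (range (\<lambda>_::nat. t)) t"
  using T_order_refl[OF assms] by (auto simp: chain_def is_join_def)

text \<open>An inequality becomes the increasing sequence s, t, t, ... with join \<open>t\<close>.
  Preservation of joins of sequences thereby yields monotonicity.\<close>

lemma chain_two:
  assumes "small Y" "(s, t) \<in> T_order Y"
  shows "chain Y (\<lambda>n::nat. if n = 0 then s else t)"
    "is_join (T_order Y) (range (\<lambda>n::nat. if n = 0 then s else t)) t"
proof -
  have "s \<in> T M Y" "t \<in> T M Y" using assms(2) by (auto simp: T_order_def)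
  note r = this[THEN T_order_refl[OF assms(1)]]
  show "chain Y (\<lambda>n::nat. if n = 0 then s else t)" using r assms(2) by (auto simp: chain_def)
  have "range (\<lambda>n::nat. if n = 0 then s else t) = {s, t}"
    by (auto simp: image_iff intro: exI[of _ 1])
  then show "is_join (T_order Y) (range (\<lambda>n::nat. if n = 0 then s else t)) t"
    using r assms(2) by (auto simp: is_join_def)
qed

lemma first_le_join:
  assumes "is_join (T_order Y) (range p) s"
  shows "(p (0::nat), s) \<in> T_order Y"
  using assms unfolding is_join_def by blast

lemma ext_chain_inner:
  assumes "small X" "small Y" "g \<in> X \<rightarrow>\<^sub>E T M Y" "chain X p" "is_join (T_order X) (range p) s"
  shows "is_join (T_order Y) (range (\<lambda>n. ext M X Y g (p n))) (ext M X Y g s)"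
  using ext_join_inner[OF assms(1-3) _ chain_directed[OF assms(4)] assms(5)] chain_in[OF assms(4)]
  by (simp add: image_subset_iff image_image)

lemma ext_mono_inner:
  assumes "small X" "small Y" "g \<in> X \<rightarrow>\<^sub>E T M Y" "(s, t) \<in> T_order X"
  shows "(ext M X Y g s, ext M X Y g t) \<in> T_order Y"
  using first_le_join[OF ext_chain_inner[OF assms(1-3) chain_two[OF assms(1,4)]]] by simp

text \<open>Iterates are compared value by value, while continuity in the outer argument concerns
  joins in \<open>hom_order\<close>. The two match because \<open>hom_order\<close> is itself
  pointwise.\<close>

lemma hom_pointwise_join:
  assumes "\<And>n. g n \<in> X \<rightarrow>\<^sub>E T M Y" "s \<in> extensional X"
    and "\<And>x. x \<in> X \<Longrightarrow> is_join (T_order Y) (range (\<lambda>n::nat. g n x)) (s x)"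
  shows "is_join (hom_order M X Y) (range g) s"
proof -
  have s: "s \<in> X \<rightarrow>\<^sub>E T M Y" using assms(2) join_in[OF assms(3)] by (auto simp: PiE_def)
  have "(g n, s) \<in> hom_order M X Y" for n
    using assms s unfolding hom_order_def is_join_def T_order_def by blast
  moreover have "(s, u) \<in> hom_order M X Y" if u: "\<forall>n. (g n, u) \<in> hom_order M X Y" for u
  proof -
    have ut: "u \<in> X \<rightarrow>\<^sub>E T M Y" using u unfolding hom_order_def by blast
    have "(s x, u x) \<in> T_order Y" if x: "x \<in> X" for x
    proof -
      have "(g n x, u x) \<in> T_order Y" for n
        using u x unfolding hom_order_def T_order_def by blast
      then show ?thesis using assms(3)[OF x] unfolding is_join_def by blast
    qed
    then show ?thesis using s ut unfolding hom_order_def T_order_def by blast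
  qed
  ultimately show ?thesis unfolding is_join_def by blast
qed

lemma ext_chain_outer:
  assumes "small X" "small Y" "t \<in> T M X"
    and g: "\<And>n. g n \<in> X \<rightarrow>\<^sub>E T M Y" and s: "s \<in> extensional X"
    and ch: "\<And>x. x \<in> X \<Longrightarrow> chain Y (\<lambda>n. g n x)"
    and jn: "\<And>x. x \<in> X \<Longrightarrow> is_join (T_order Y) (range (\<lambda>n::nat. g n x)) (s x)"
  shows "is_join (T_order Y) (range (\<lambda>n. ext M X Y (g n) t)) (ext M X Y s t)"
proof -
  have "(g m, g n) \<in> hom_order M X Y" if "m \<le> n" for m n
    using g ch that unfolding hom_order_def chain_def T_order_def by blast
  then have "\<exists>z\<in>range g. (g m, z) \<in> hom_order M X Y \<and> (g n, z) \<in> hom_order M X Y" for m n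
    by (intro bexI[of _ "g (max m n)"]) auto
  then have "directed (hom_order M X Y) (range g)" unfolding directed_def by blast
  then show ?thesis
    using ext_join_outer[OF assms(1-3) _ _ hom_pointwise_join[OF g s jn]] g
    by (simp add: image_subset_iff image_image)
qed

lemma Tmap_bottom:
  assumes "small X" "small Y" "u \<in> X \<rightarrow>\<^sub>E Y" "u ` X = Y"
  shows "Tmap M X Y u (bottom M X) = bottom M Y"
proof -
  \<comment> \<open>A section of the surjection \<open>u\<close>.\<close>
  define s where "s = (\<lambda>y\<in>Y. inv_into X u y)"
  have s: "s \<in> Y \<rightarrow>\<^sub>E X" using assms(4) by (auto simp: s_def inv_into_into)
  have us: "compose Y u s = (\<lambda>y\<in>Y. y)"
    using assms(4) by (auto simp: s_def compose_def f_inv_into_f intro!: restrict_ext)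
  note bX = bottom_least[OF assms(1)] and bY = bottom_least[OF assms(2)]
  have "(bottom M X, Tmap M Y X s (bottom M Y)) \<in> T_order X"
    using bX bY Tmap_in[OF assms(2,1) s] by blast
  then have "(Tmap M X Y u (bottom M X), Tmap M X Y u (Tmap M Y X s (bottom M Y))) \<in> T_order Y"
    unfolding Tmap_def[of M X Y] using assms by (intro ext_mono_inner ret_comp_type)
  \<comment> \<open>By functoriality the upper bound is the image of \<open>bottom M Y\<close> under
    \<open>T\<close> of the identity \<open>u\<close> after \<open>s\<close>.\<close>
  also have "Tmap M X Y u (Tmap M Y X s (bottom M Y)) = bottom M Y"
    using Tmap_Tmap[OF assms(2,1,2,3) s] bY us Tmap_id[OF assms(2)] by simp
  finally have "(Tmap M X Y u (bottom M X), bottom M Y) \<in> T_order Y" .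
  moreover have "(bottom M Y, Tmap M X Y u (bottom M X)) \<in> T_order Y"
    using bX bY Tmap_in[OF assms(1-3)] by blast
  ultimately show ?thesis using antisymD[OF T_order_antisym[OF assms(2)]] by blast
qed

end

section \<open>Continuity of algebraic operations\<close>

locale effectful_monad = universe_ordered_monad small code M + algebraic_operation small M oplus
  for small :: "'u set \<Rightarrow> bool"
    and code :: "'u set \<Rightarrow> 'u"
    and M :: "('u, 't, 'm) ordered_kleisli_scheme"
    and oplus :: "'u set \<Rightarrow> 't \<Rightarrow> 't \<Rightarrow> 't"
begin

text \<open>Once the operation is written as the extension of a map on two elements, applied to a
  fixed element, both operands sit in the extended map. Joint continuity then follows from
  continuity in the outer argument.\<close>

lemma oplus_chain:
  assumes "small Y" "chain Y p" "is_join (T_order Y) (range p) s"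
    and "chain Y q" "is_join (T_order Y) (range q) t"
  shows "is_join (T_order Y) (range (\<lambda>n. oplus Y (p n) (q n))) (oplus Y s t)"
proof -
  obtain c d :: 'u where cd: "c \<noteq> d" by (rule two_elements)
  define choice where "choice p q = (\<lambda>i\<in>{c, d}. if i = c then p else q)" for p q :: 't
  have sm: "small {c, d}" by (simp add: small_finite)
  have ty: "choice p q \<in> {c, d} \<rightarrow>\<^sub>E T M Y" if "p \<in> T M Y" "q \<in> T M Y" for p q
    using that by (auto simp: choice_def)
  \<comment> \<open>The generic effect: the operation applied to the two units. Algebraicity along
    \<open>choice p q\<close> sends it to \<open>oplus Y p q\<close>.\<close>
  define e where "e = oplus {c, d} (ret M {c, d} c) (ret M {c, d} d)"
  have e: "e \<in> T M {c, d}" unfolding e_def using sm by (intro oplus_type ret_in) auto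
  have eq: "oplus Y p q = ext M {c, d} Y (choice p q) e" if "p \<in> T M Y" "q \<in> T M Y" for p q
  proof -
    have "ext M {c, d} Y (choice p q) (ret M {c, d} c) = p"
      "ext M {c, d} Y (choice p q) (ret M {c, d} d) = q"
      using cd by (simp_all add: ext_ret_apply[OF sm assms(1) ty[OF that]]) (simp_all add: choice_def)
    then show ?thesis
      using oplus_algebraic[OF sm assms(1) ty[OF that] ret_in[OF sm, of c] ret_in[OF sm, of d]]
      by (simp add: e_def)
  qed
  have "is_join (T_order Y) (range (\<lambda>n. ext M {c, d} Y (choice (p n) (q n)) e))
      (ext M {c, d} Y (choice s t) e)"
  proof (rule ext_chain_outer[OF sm assms(1) e])
    show "choice (p n) (q n) \<in> {c, d} \<rightarrow>\<^sub>E T M Y" for n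
      using assms chain_in by (intro ty) auto
    show "choice s t \<in> extensional {c, d}" by (simp add: choice_def)
    show "chain Y (\<lambda>n. choice (p n) (q n) x)" if "x \<in> {c, d}" for x
      using that assms cd by (auto simp: choice_def)
    show "is_join (T_order Y) (range (\<lambda>n. choice (p n) (q n) x)) (choice s t x)"
      if "x \<in> {c, d}" for x
      using that assms cd by (auto simp: choice_def)
  qed
  moreover have "s \<in> T M Y" "t \<in> T M Y" using assms join_in by auto
  ultimately show ?thesis using eq chain_in[OF assms(2)] chain_in[OF assms(4)] by simp
qed

end

section \<open>The unfolding operator of the observation equation\<close>

locale observed_coalgebra = effectful_monad small code M oplus
  for small :: "'u set \<Rightarrow> bool"
    and code :: "'u set \<Rightarrow> 'u"
    and M :: "('u, 't, 'm) ordered_kleisli_scheme"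
    and oplus :: "'u set \<Rightarrow> 't \<Rightarrow> 't \<Rightarrow> 't" +
  fixes A X :: "'u set" and B :: "'u list set set" and f :: "'u \<Rightarrow> 't"
  assumes small_A: "small A" and pattern: "observation_pattern A B"
    and small_X: "small X" and f_type: "f \<in> X \<rightarrow>\<^sub>E T M (prod_obj code X A)"
begin

lemmas small_XA = small_prod_obj[OF small_X small_A]

lemma f_in: "x \<in> X \<Longrightarrow> f x \<in> T M (prod_obj code X A)"
  using f_type by auto

lemma deriv_in: "b \<in> B \<Longrightarrow> a \<in> A \<Longrightarrow> word_deriv a b \<in> B"
  using pattern unfolding observation_pattern_def by blast

text \<open>Restricting to \<open>X\<close> and \<open>B\<close> makes every value extensional, so
  that solutions are literal fixed points, equal as HOL functions.\<close>

definition obs_step :: "'u set \<Rightarrow> ('u \<Rightarrow> 'u) \<Rightarrow> ('u \<Rightarrow> 'u list set \<Rightarrow> 't) \<Rightarrow> 'u \<Rightarrow> 'u list set \<Rightarrow> 't" where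
  "obs_step Y h g = (\<lambda>x\<in>X. \<lambda>b\<in>B.
      oplus Y (if [] \<in> b then ret M Y (h x) else bottom M Y)
        (ext M (prod_obj code X A) Y (uncurry code X A (\<lambda>y a. g y (word_deriv a b))) (f x)))"

lemma obs_solution_iff:
  "obs_solution code M oplus A B X f Y h g \<longleftrightarrow> g \<in> X \<rightarrow>\<^sub>E powT M B Y \<and> obs_step Y h g = g"
proof -
  have "(\<forall>x\<in>X. \<forall>b\<in>B. g x b = obs_step Y h g x b) \<longleftrightarrow> obs_step Y h g = g"
    if g: "g \<in> X \<rightarrow>\<^sub>E powT M B Y"
  proof
    assume *: "\<forall>x\<in>X. \<forall>b\<in>B. g x b = obs_step Y h g x b"
    \<comment> \<open>Outside \<open>X\<close> and outside \<open>B\<close> both sides take the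
      default value.\<close>
    have "obs_step Y h g x b = g x b" for x b
    proof (cases "x \<in> X")
      case True
      then have "g x \<in> extensional B" using g unfolding powT_def by (auto simp: PiE_def)
      then show ?thesis using True * by (cases "b \<in> B") (auto simp: obs_step_def extensional_def)
    next
      case False
      then show ?thesis using g by (auto simp: obs_step_def PiE_def extensional_def)
    qed
    then show "obs_step Y h g = g" by blast
  qed simp
  then show ?thesis unfolding obs_solution_def by (auto simp: obs_step_def)
qed

text \<open>Since \<open>B\<close> need not be small, maps into the power \<open>(T Y)\<^sup>B\<close> are compared pointwise.\<close>

definition obs_type :: "'u set \<Rightarrow> ('u \<Rightarrow> 'u list set \<Rightarrow> 't) \<Rightarrow> bool" where
  "obs_type Y g \<longleftrightarrow> (\<forall>x\<in>X. \<forall>b\<in>B. g x b \<in> T M Y)"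

text \<open>Closure of the pattern under derivatives keeps the recursive call inside
  \<open>B\<close>.\<close>

lemma obs_unfold_type:
  assumes "obs_type Y g" "b \<in> B"
  shows "uncurry code X A (\<lambda>y a. g y (word_deriv a b)) \<in> prod_obj code X A \<rightarrow>\<^sub>E T M Y"
  using assms deriv_in unfolding obs_type_def by (intro uncurry_type) auto

lemma unit_or_bottom_in:
  assumes "small Y" "h \<in> X \<rightarrow>\<^sub>E Y" "x \<in> X"
  shows "(if [] \<in> b then ret M Y (h x) else bottom M Y) \<in> T M Y"
  using assms ret_in[of Y "h x"] bottom_in by auto

lemma obs_step_type:
  assumes "small Y" "h \<in> X \<rightarrow>\<^sub>E Y" "obs_type Y g"
  shows "obs_type Y (obs_step Y h g)"
  unfolding obs_type_def
proof (intro ballI)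
  fix x b assume "x \<in> X" "b \<in> B"
  then show "obs_step Y h g x b \<in> T M Y"
    using oplus_type[OF assms(1) unit_or_bottom_in[OF assms(1,2), of x b]
        ext_in[OF small_XA assms(1) obs_unfold_type[OF assms(3), of b] f_in, of x]]
    by (simp add: obs_step_def del: if_split)
qed

text \<open>The recursive call enters the step through the extended map and then through the second
  operand of the operation; both dependencies preserve joins of chains.\<close>

lemma obs_step_chain:
  assumes "small Y" "h \<in> X \<rightarrow>\<^sub>E Y" "x \<in> X" "b \<in> B"
    and ch: "\<And>x b. x \<in> X \<Longrightarrow> b \<in> B \<Longrightarrow> chain Y (\<lambda>n. g n x b)"
    and jn: "\<And>x b. x \<in> X \<Longrightarrow> b \<in> B \<Longrightarrow> is_join (T_order Y) (range (\<lambda>n. g n x b)) (s x b)"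
  shows "is_join (T_order Y) (range (\<lambda>n. obs_step Y h (g n) x b)) (obs_step Y h s x b)"
proof -
  let ?P = "prod_obj code X A"
  let ?u = "\<lambda>g. uncurry code X A (\<lambda>y a. g y (word_deriv a b))"
  have g: "obs_type Y (g n)" for n using chain_in[OF ch] unfolding obs_type_def by blast
  have u: "?u (g n) \<in> ?P \<rightarrow>\<^sub>E T M Y" for n using obs_unfold_type[OF g assms(4)] .
  have uch: "chain Y (\<lambda>n. ?u (g n) p)"
    and ujn: "is_join (T_order Y) (range (\<lambda>n. ?u (g n) p)) (?u s p)" if p: "p \<in> ?P" for p
  proof -
    obtain y a where ya: "y \<in> X" "a \<in> A"
      and inv: "inv_into (X \<times> A) (\<lambda>(x, a). pr code x a) p = (y, a)"
      by (rule prod_obj_inv[OF p])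
    have u_eq: "?u k p = k y (word_deriv a b)" for k using p inv by (simp add: uncurry_def)
    show "chain Y (\<lambda>n. ?u (g n) p)"
      unfolding u_eq by (rule ch[OF ya(1) deriv_in[OF assms(4) ya(2)]])
    show "is_join (T_order Y) (range (\<lambda>n. ?u (g n) p)) (?u s p)"
      unfolding u_eq by (rule jn[OF ya(1) deriv_in[OF assms(4) ya(2)]])
  qed
  \<comment> \<open>Continuity of the operation asks its operands to form chains, so monotonicity in
    the extended map comes first; it is continuity along a sequence that changes only once.\<close>
  have mono: "(ext M ?P Y (?u (g m)) (f x), ext M ?P Y (?u (g n)) (f x)) \<in> T_order Y"
    if "m \<le> n" for m n
  proof -
    have le: "(?u (g m) p, ?u (g n) p) \<in> T_order Y" if "p \<in> ?P" for p
      using uch[OF that] \<open>m \<le> n\<close> unfolding chain_def by blast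
    have "is_join (T_order Y)
        (range (\<lambda>k::nat. ext M ?P Y (if k = 0 then ?u (g m) else ?u (g n)) (f x)))
        (ext M ?P Y (?u (g n)) (f x))"
    proof (rule ext_chain_outer[OF small_XA assms(1) f_in[OF assms(3)]])
      fix p assume p: "p \<in> ?P"
      show "chain Y (\<lambda>k. (if k = 0 then ?u (g m) else ?u (g n)) p)"
        using chain_two(1)[OF assms(1) le[OF p]] by (simp add: if_distribR)
      show "is_join (T_order Y) (range (\<lambda>k::nat. (if k = 0 then ?u (g m) else ?u (g n)) p))
          (?u (g n) p)"
        using chain_two(2)[OF assms(1) le[OF p]] by (simp add: if_distribR)
    qed (use u in \<open>auto simp: PiE_def\<close>)
    from first_le_join[OF this] show ?thesis by simp
  qed
  have ech: "chain Y (\<lambda>n. ext M ?P Y (?u (g n)) (f x))" using mono unfolding chain_def by blast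
  have "is_join (T_order Y) (range (\<lambda>n. ext M ?P Y (?u (g n)) (f x))) (ext M ?P Y (?u s) (f x))"
    by (rule ext_chain_outer[OF small_XA assms(1) f_in[OF assms(3)] u _ uch ujn])
      (unfold uncurry_def, rule restrict_extensional)
  \<comment> \<open>The first operand does not depend on the recursive call and enters as a constant
    chain.\<close>
  from oplus_chain[OF assms(1) chain_const[OF assms(1) unit_or_bottom_in[OF assms(1-3), of b]]
      ech this]
  show ?thesis using assms(3,4) by (simp add: obs_step_def del: if_split)
qed

lemma obs_step_mono:
  assumes "small Y" "h \<in> X \<rightarrow>\<^sub>E Y" "x \<in> X" "b \<in> B"
    and le: "\<And>x b. x \<in> X \<Longrightarrow> b \<in> B \<Longrightarrow> (g x b, g' x b) \<in> T_order Y"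
  shows "(obs_step Y h g x b, obs_step Y h g' x b) \<in> T_order Y"
proof -
  have "is_join (T_order Y) (range (\<lambda>n::nat. obs_step Y h (if n = 0 then g else g') x b))
      (obs_step Y h g' x b)"
    using obs_step_chain[OF assms(1-4), of "\<lambda>n. if n = 0 then g else g'" g']
      chain_two[OF assms(1) le] by (simp add: if_distribR)
  from first_le_join[OF this] show ?thesis by simp
qed

section \<open>Kleene iteration and the least solution\<close>

definition obs_iter :: "'u set \<Rightarrow> ('u \<Rightarrow> 'u) \<Rightarrow> nat \<Rightarrow> 'u \<Rightarrow> 'u list set \<Rightarrow> 't" where
  "obs_iter Y h n = (obs_step Y h ^^ n) (\<lambda>x b. bottom M Y)"

lemma obs_iter_Suc: "obs_iter Y h (Suc n) = obs_step Y h (obs_iter Y h n)"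
  by (simp add: obs_iter_def)

text \<open>Typing is pointwise because the zeroth iterate is bottom at all arguments, without
  restriction to \<open>X\<close> and \<open>B\<close>.\<close>

lemma obs_iter_type:
  assumes "small Y" "h \<in> X \<rightarrow>\<^sub>E Y"
  shows "obs_type Y (obs_iter Y h n)"
proof (induction n)
  case 0
  show ?case using bottom_in[OF assms(1)] by (simp add: obs_iter_def obs_type_def)
next
  case (Suc n)
  then show ?case unfolding obs_iter_Suc by (rule obs_step_type[OF assms])
qed

lemma obs_iter_chain:
  assumes "small Y" "h \<in> X \<rightarrow>\<^sub>E Y" "x \<in> X" "b \<in> B"
  shows "chain Y (\<lambda>n. obs_iter Y h n x b)"
proof (rule chain_SucI[OF assms(1)])
  fix n
  show "(obs_iter Y h n x b, obs_iter Y h (Suc n) x b) \<in> T_order Y"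
    using assms(3,4)
  \<comment> \<open>The recursive call visits other states and derivatives of \<open>b\<close>,
    hence the generalisation over both.\<close>
  proof (induction n arbitrary: x b)
    case 0
    then show ?case
      using obs_iter_type[OF assms(1,2), of "Suc 0"] bottom_least[OF assms(1)]
      unfolding obs_type_def by (simp add: obs_iter_def)
  next
    case (Suc n)
    show ?case
      using obs_step_mono[OF assms(1,2) Suc.prems Suc.IH] by (simp add: obs_iter_Suc)
  qed
qed

text \<open>Kleene's fixed point argument: by continuity the pointwise join of the iterates solves
  the equation, and by induction every iterate lies below every solution. So the description
  defining \<open>obs\<close> denotes this join.\<close>

lemma obs_kleene:
  assumes "small Y" "h \<in> X \<rightarrow>\<^sub>E Y"
  shows "obs code M oplus A B X f Y h \<in> X \<rightarrow>\<^sub>E powT M B Y"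
    and "x \<in> X \<Longrightarrow> b \<in> B \<Longrightarrow>
      is_join (T_order Y) (range (\<lambda>n. obs_iter Y h n x b)) (obs code M oplus A B X f Y h x b)"
proof -
  let ?sol = "obs_solution code M oplus A B X f Y h"
  define s where "s = (\<lambda>x\<in>X. \<lambda>b\<in>B. SOME t. is_join (T_order Y) (range (\<lambda>n. obs_iter Y h n x b)) t)"
  have jn: "is_join (T_order Y) (range (\<lambda>n. obs_iter Y h n x b)) (s x b)"
    if xb: "x \<in> X" "b \<in> B" for x b
  proof -
    obtain t where "is_join (T_order Y) (range (\<lambda>n. obs_iter Y h n x b)) t"
      using chain_join[OF assms(1) obs_iter_chain[OF assms xb]] .
    then show ?thesis using xb by (auto simp: s_def intro: someI)
  qed
  have sty: "s \<in> X \<rightarrow>\<^sub>E powT M B Y"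
  proof
    fix x assume x: "x \<in> X"
    show "s x \<in> powT M B Y"
      unfolding powT_def
    proof
      show "s x b \<in> T M Y" if "b \<in> B" for b using join_in[OF jn[OF x that]] .
      show "s x b = undefined" if "b \<notin> B" for b using x that by (simp add: s_def)
    qed
  qed (simp add: s_def)
  have fixpt: "obs_step Y h s x b = s x b" if x: "x \<in> X" and b: "b \<in> B" for x b
  proof -
    have "is_join (T_order Y) (range (\<lambda>n. obs_iter Y h (Suc n) x b)) (obs_step Y h s x b)"
      unfolding obs_iter_Suc using obs_step_chain[OF assms x b obs_iter_chain[OF assms] jn] .
    \<comment> \<open>Dropping the zeroth iterate leaves the join unchanged, since it lies below the
      first.\<close>
    moreover have "is_join (T_order Y) (range (\<lambda>n. obs_iter Y h (Suc n) x b)) (s x b)"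
      unfolding is_join_def
    proof (intro conjI allI impI ballI)
      fix d assume "d \<in> range (\<lambda>n. obs_iter Y h (Suc n) x b)"
      then show "(d, s x b) \<in> T_order Y" using jn[OF x b] unfolding is_join_def by blast
    next
      fix u assume u: "\<forall>d\<in>range (\<lambda>n. obs_iter Y h (Suc n) x b). (d, u) \<in> T_order Y"
      have "(obs_iter Y h n x b, u) \<in> T_order Y" for n
      proof -
        have "(obs_iter Y h n x b, obs_iter Y h (Suc n) x b) \<in> T_order Y"
          using obs_iter_chain[OF assms x b] unfolding chain_def by simp
        then show ?thesis using u transD[OF T_order_trans[OF assms(1)]] by blast
      qed
      then show "(s x b, u) \<in> T_order Y" using jn[OF x b] unfolding is_join_def by blast
    qed
    ultimately show ?thesis using is_join_unique T_order_antisym[OF assms(1)] by metis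
  qed
  have ssol: "?sol s"
    unfolding obs_solution_iff
  proof
    show "obs_step Y h s = s"
    proof (intro ext)
      fix x b show "obs_step Y h s x b = s x b"
        using fixpt[of x b] by (cases "x \<in> X"; cases "b \<in> B") (simp_all add: obs_step_def s_def)
    qed
  qed (rule sty)
  have least: "(s x b, g x b) \<in> T_order Y" if g: "?sol g" and x: "x \<in> X" and b: "b \<in> B" for g x b
  proof -
    have gX: "obs_type Y g" and gfix: "obs_step Y h g = g"
      using g unfolding obs_solution_iff obs_type_def powT_def by auto
    have "(obs_iter Y h n x b, g x b) \<in> T_order Y" if "x \<in> X" "b \<in> B" for n x b
      using that
    proof (induction n arbitrary: x b)
      case 0
      then show ?case using gX bottom_least[OF assms(1)] by (auto simp: obs_iter_def obs_type_def)
    next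
      case (Suc n)
      then show ?case
        using obs_step_mono[OF assms Suc.prems, of "obs_iter Y h n" g] by (simp add: obs_iter_Suc gfix)
    qed
    then show ?thesis using jn[OF x b] x b unfolding is_join_def by blast
  qed
  have "obs code M oplus A B X f Y h = s"
    unfolding obs_def
  proof (rule the_equality)
    show "?sol s \<and> (\<forall>g'. ?sol g' \<longrightarrow> (\<forall>x\<in>X. \<forall>b\<in>B. leq M Y (s x b) (g' x b)))"
      using ssol least unfolding T_order_def by blast
  next
    fix g assume g: "?sol g \<and> (\<forall>g'. ?sol g' \<longrightarrow> (\<forall>x\<in>X. \<forall>b\<in>B. leq M Y (g x b) (g' x b)))"
    then have gty: "g \<in> X \<rightarrow>\<^sub>E powT M B Y" unfolding obs_solution_iff by blast
    have "g x = s x" if x: "x \<in> X" for x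
    proof (rule PiE_ext)
      show "g x \<in> B \<rightarrow>\<^sub>E T M Y" "s x \<in> B \<rightarrow>\<^sub>E T M Y"
        using gty sty x unfolding powT_def by auto
      fix b assume b: "b \<in> B"
      have "(s x b, g x b) \<in> T_order Y" using least g x b by blast
      \<comment> \<open>Minimality of \<open>g\<close> against the solution \<open>s\<close> gives
        only \<open>leq\<close>; membership in the carrier is taken from the previous
        inequality.\<close>
      moreover from this have "(g x b, s x b) \<in> T_order Y"
        using g ssol x b unfolding T_order_def by blast
      ultimately show "g x b = s x b" using antisymD[OF T_order_antisym[OF assms(1)]] by blast
    qed
    then show "g = s" using gty sty by (rule PiE_ext[rotated 2])
  qed
  then show "obs code M oplus A B X f Y h \<in> X \<rightarrow>\<^sub>E powT M B Y"
    and "x \<in> X \<Longrightarrow> b \<in> B \<Longrightarrow>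
      is_join (T_order Y) (range (\<lambda>n. obs_iter Y h n x b)) (obs code M oplus A B X f Y h x b)"
    using sty jn by simp_all
qed

section \<open>Transport of observations along surjections\<close>

lemma id_type: "(\<lambda>x\<in>X. x) \<in> X \<rightarrow>\<^sub>E X"
  by simp

text \<open>\<open>T h\<close> passes through every layer of the step: it commutes with the
  operation by naturality, sends units to units and, \<open>h\<close> being surjective, bottom to
  bottom, and it is absorbed by Kleisli extension into the recursive call.\<close>

lemma Tmap_obs_iter:
  assumes "small Y" "h \<in> X \<rightarrow>\<^sub>E Y" "h ` X = Y" "x \<in> X" "b \<in> B"
  shows "Tmap M X Y h (obs_iter X (\<lambda>x\<in>X. x) n x b) = obs_iter Y h n x b"
  using assms(4,5)
proof (induction n arbitrary: x b)
  case 0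
  then show ?case using Tmap_bottom[OF small_X assms(1-3)] by (simp add: obs_iter_def)
next
  case (Suc n)
  let ?P = "prod_obj code X A" and ?g = "obs_iter X (\<lambda>x\<in>X. x) n"
  let ?u = "\<lambda>g. uncurry code X A (\<lambda>y a. g y (word_deriv a b))"
  let ?e = "if [] \<in> b then ret M X x else bottom M X"
  have u: "?u ?g \<in> ?P \<rightarrow>\<^sub>E T M X"
    by (rule obs_unfold_type[OF obs_iter_type[OF small_X id_type] Suc.prems(2)])
  have e: "?e \<in> T M X"
    using unit_or_bottom_in[OF small_X id_type Suc.prems(1), of b] Suc.prems
    by (simp split: if_splits)
  \<comment> \<open>The induction hypothesis at the derivatives of \<open>b\<close>, applied under
    the decoding of pairs.\<close>
  have "uncurry code X A (\<lambda>y a. Tmap M X Y h (?g y (word_deriv a b))) = ?u (obs_iter Y h n)"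
  proof
    fix p
    show "uncurry code X A (\<lambda>y a. Tmap M X Y h (?g y (word_deriv a b))) p = ?u (obs_iter Y h n) p"
    proof (cases "p \<in> ?P")
      case True
      then obtain y a where ya: "y \<in> X" "a \<in> A"
        and inv: "inv_into (X \<times> A) (\<lambda>(x, a). pr code x a) p = (y, a)"
        by (rule prod_obj_inv)
      have "uncurry code X A k p = k y a" for k :: "'u \<Rightarrow> 'u \<Rightarrow> 't"
        using True inv by (simp add: uncurry_def)
      note eq = this[of "\<lambda>y a. Tmap M X Y h (?g y (word_deriv a b))"]
        this[of "\<lambda>y a. obs_iter Y h n y (word_deriv a b)"]
      show ?thesis unfolding eq by (rule Suc.IH[OF ya(1) deriv_in[OF Suc.prems(2) ya(2)]])
    qed (simp add: uncurry_def)
  qed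
  then have "Tmap M X Y h (ext M ?P X (?u ?g) (f x)) = ext M ?P Y (?u (obs_iter Y h n)) (f x)"
    using Tmap_ext[OF small_XA small_X assms(1,2) u f_in[OF Suc.prems(1)]]
    by (simp add: compose_uncurry)
  moreover have "Tmap M X Y h ?e = (if [] \<in> b then ret M Y (h x) else bottom M Y)"
    using Tmap_ret[OF small_X assms(1,2) Suc.prems(1)] Tmap_bottom[OF small_X assms(1-3)] by simp
  ultimately show ?case
    using oplus_natural[OF small_X assms(1,2) e ext_in[OF small_XA small_X u f_in[OF Suc.prems(1)]]]
      Suc.prems
    by (simp add: obs_iter_Suc obs_step_def restrict_apply' del: restrict_apply if_split)
qed

abbreviation obs_id :: "'u \<Rightarrow> 'u list set \<Rightarrow> 't" where
  "obs_id \<equiv> obs code M oplus A B X f X (\<lambda>x\<in>X. x)"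

lemma obs_id_type: "x \<in> X \<Longrightarrow> obs_id x \<in> B \<rightarrow>\<^sub>E T M X"
  using obs_kleene(1)[OF small_X id_type] unfolding powT_def by auto

text \<open>\<open>T h\<close> is a Kleisli extension and so preserves the join of the iterates;
  both sides are then joins of the same sequence.\<close>

lemma Tmap_obs:
  assumes "small Y" "h \<in> X \<rightarrow>\<^sub>E Y" "h ` X = Y" "x \<in> X" "b \<in> B"
  shows "Tmap M X Y h (obs_id x b) = obs code M oplus A B X f Y h x b"
proof -
  have "is_join (T_order Y) (range (\<lambda>n. Tmap M X Y h (obs_iter X (\<lambda>x\<in>X. x) n x b)))
      (Tmap M X Y h (obs_id x b))"
    unfolding Tmap_def
    using ext_chain_inner[OF small_X assms(1) ret_comp_type[OF assms(1,2)]
        obs_iter_chain[OF small_X id_type assms(4,5)] obs_kleene(2)[OF small_X id_type assms(4,5)]] .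
  then show ?thesis
    unfolding Tmap_obs_iter[OF assms]
    using obs_kleene(2)[OF assms(1,2,4,5)] T_order_antisym[OF assms(1)] by (rule is_join_unique)
qed

lemma powT_map_obs:
  assumes "small Y" "h \<in> X \<rightarrow>\<^sub>E Y" "h ` X = Y" "x \<in> X"
  shows "powT_map M B X Y h (obs_id x) = obs code M oplus A B X f Y h x"
proof
  fix b
  have "obs code M oplus A B X f Y h x \<in> extensional B"
    using obs_kleene(1)[OF assms(1,2)] assms(4) unfolding powT_def by (auto simp: PiE_def)
  then show "powT_map M B X Y h (obs_id x) b = obs code M oplus A B X f Y h x b"
    using Tmap_obs[OF assms] obs_id_type[OF assms(4)]
    by (cases "b \<in> B") (simp_all add: powT_map_def powT_def extensional_def)
qed

section \<open>Bisimulations and kernels of coalgebra morphisms\<close>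

theorem B_bisimulation_iff_kernel_bisimulation:
  assumes E: "equiv X E"
  shows "B_bisimulation code M oplus A B X f E \<longleftrightarrow>
    kernel_bisimulation small (powT M B) (powT_map M B) X obs_id E"
proof -
  define Q where "Q = quot code X E"
  define \<pi> where "\<pi> = quot_proj code X E"
  let ?obs = "obs code M oplus A B X f Q \<pi>"
  have Q: "small Q" unfolding Q_def using small_quot[OF small_X] .
  have \<pi>: "\<pi> \<in> X \<rightarrow>\<^sub>E Q" and surj: "\<pi> ` X = Q" and ker: "ker X \<pi> = E"
    unfolding Q_def \<pi>_def using quot_proj_type quot_proj_surj ker_quot_proj[OF small_X E] by auto
  have bis: "B_bisimulation code M oplus A B X f E \<longleftrightarrow> E \<subseteq> ker X ?obs"
    using E by (simp add: B_bisimulation_def Q_def \<pi>_def)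
  show ?thesis unfolding bis
  proof
    assume sub: "E \<subseteq> ker X ?obs"
    \<comment> \<open>The coalgebra structure on the quotient observes a chosen representative of
      each class.\<close>
    define l where "l = (\<lambda>q\<in>Q. ?obs (inv_into X \<pi> q))"
    have rep: "inv_into X \<pi> q \<in> X" "\<pi> (inv_into X \<pi> q) = q" if "q \<in> Q" for q
      using that surj by (auto simp: inv_into_into f_inv_into_f)
    have l: "l \<in> Q \<rightarrow>\<^sub>E powT M B Q"
      using obs_kleene(1)[OF Q \<pi>] rep(1) unfolding l_def by auto
    have "l (\<pi> x) = powT_map M B X Q \<pi> (obs_id x)" if x: "x \<in> X" for x
    proof -
      have q: "\<pi> x \<in> Q" using \<pi> x by auto
      have "(inv_into X \<pi> (\<pi> x), x) \<in> ker X \<pi>" using rep[OF q] x by (simp add: ker_def)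
      \<comment> \<open>Independence of the representative is exactly the bisimulation
        condition.\<close>
      then have "?obs (inv_into X \<pi> (\<pi> x)) = ?obs x" using sub ker by (auto simp: ker_def)
      then show ?thesis using q powT_map_obs[OF Q \<pi> surj x] by (simp add: l_def)
    qed
    then have "compose X l \<pi> = compose X (powT_map M B X Q \<pi>) obs_id"
      by (auto simp: compose_def intro!: restrict_ext)
    then show "kernel_bisimulation small (powT M B) (powT_map M B) X obs_id E"
      unfolding kernel_bisimulation_def coalgebra_morphism_def using Q l \<pi> ker by blast
  next
    assume "kernel_bisimulation small (powT M B) (powT_map M B) X obs_id E"
    then obtain Z l \<phi> where Z: "small Z" and \<phi>: "\<phi> \<in> X \<rightarrow>\<^sub>E Z"
      and mor: "compose X l \<phi> = compose X (powT_map M B X Z \<phi>) obs_id" and E\<phi>: "E = ker X \<phi>"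
      unfolding kernel_bisimulation_def coalgebra_morphism_def by blast
    have mor': "l (\<phi> x) b = Tmap M X Z \<phi> (obs_id x b)" if "x \<in> X" "b \<in> B" for x b
      using fun_cong[OF fun_cong[OF mor, of x], of b] that obs_id_type[OF that(1)]
      by (simp add: compose_def powT_map_def powT_def)
    show "E \<subseteq> ker X ?obs"
    proof
      fix e assume e: "e \<in> E"
      obtain x y where xy: "e = (x, y)" "x \<in> X" "y \<in> X" "\<phi> x = \<phi> y"
        using e E\<phi> by (auto simp: ker_def)
      \<comment> \<open>A retraction of the injection from the quotient into \<open>Z\<close>
        induced by \<phi>. Off the image of \<phi> it needs some value in \<open>Q\<close>, and the
        given \<open>x\<close> supplies one.\<close>
      define r where "r = (\<lambda>z\<in>Z. if z \<in> \<phi> ` X then \<pi> (inv_into X \<phi> z) else \<pi> x)"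
      have r: "r \<in> Z \<rightarrow>\<^sub>E Q" using PiE_mem[OF \<pi>] xy(2) by (simp add: r_def inv_into_into)
      have "r (\<phi> w) = \<pi> w" if w: "w \<in> X" for w
      proof -
        have "(inv_into X \<phi> (\<phi> w), w) \<in> ker X \<phi>"
          using w by (simp add: ker_def inv_into_into f_inv_into_f)
        then have "\<pi> (inv_into X \<phi> (\<phi> w)) = \<pi> w" using E\<phi> ker by (auto simp: ker_def)
        then show ?thesis using w \<phi> by (auto simp: r_def)
      qed
      then have r\<phi>: "compose X r \<phi> = \<pi>"
        using \<pi> by (auto simp: compose_def PiE_def extensional_def)
      \<comment> \<open>As \<pi> is \<open>r\<close> after \<phi>, the morphism equation makes the
        observation at \<open>w\<close> a function of \<phi> at \<open>w\<close> alone.\<close>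
      have obs: "?obs w b = Tmap M Z Q r (l (\<phi> w) b)" if "w \<in> X" "b \<in> B" for w b
        using Tmap_Tmap[OF small_X Z Q r \<phi> PiE_mem[OF obs_id_type[OF that(1)] that(2)]] that
        by (simp add: r\<phi> mor' Tmap_obs[OF Q \<pi> surj])
      have "?obs x = ?obs y"
      proof (rule PiE_ext)
        show "?obs x \<in> B \<rightarrow>\<^sub>E T M Q" "?obs y \<in> B \<rightarrow>\<^sub>E T M Q"
          using obs_kleene(1)[OF Q \<pi>] xy unfolding powT_def by auto
        show "?obs x b = ?obs y b" if "b \<in> B" for b using obs that xy by simp
      qed
      then show "e \<in> ker X ?obs" using xy by (simp add: ker_def)
    qed
  qed
qed

end

theorem theorem16:
  fixes small :: "'u set \<Rightarrow> bool"
    and code :: "'u set \<Rightarrow> 'u"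
    and M :: "('u, 't) ordered_kleisli"
    and oplus :: "'u set \<Rightarrow> 't \<Rightarrow> 't \<Rightarrow> 't"
    and A X :: "'u set"
    and B :: "'u list set set"
    and f :: "'u \<Rightarrow> 't"
    and E :: "'u rel"
  assumes "set_universe small code"
    and "completely_ordered_monad small M"
    and "algebraic_operation small M oplus"
    and "small A" and "observation_pattern A B"
    and "small X" and "f \<in> X \<rightarrow>\<^sub>E T M (prod_obj code X A)"
    and "equiv X E"
  shows "B_bisimulation code M oplus A B X f E \<longleftrightarrow>
    kernel_bisimulation small (powT M B) (powT_map M B) X
      (obs code M oplus A B X f X (\<lambda>x\<in>X. x)) E"
proof -
  interpret observed_coalgebra small code M oplus A X B f
    using assms
    by (intro observed_coalgebra.intro observed_coalgebra_axioms.intro effectful_monad.intro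
        universe_ordered_monad.intro)
  show ?thesis using assms(8) by (rule B_bisimulation_iff_kernel_bisimulation)
qed

end
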